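(* Let $G\in\Sigma$, with expansion $G(Z)=Z+B_0+\sum_{n=1}^{\infty}B_nZ^{-n}$ for $Z\in\Delta$ (so $Z\notin\mathcal{O}_0$), where $B_n\in\mathbb{BC}$. Then $$\sum_{n=1}^{\infty} n\,|B_n|_{\mathbf{k}}^{2}\preceq 1.$$
   Context: Bicomplex numbers: $\mathbb{BC}=\{Z_1+\mathbf{j}Z_2: Z_1,Z_2\in\mathbb{C}(\mathbf{i})\}$, where $\mathbf{i}\neq\mathbf{j}$, $\mathbf{i}\mathbf{j}=\mathbf{j}\mathbf{i}=\mathbf{k}$, $\mathbf{i}^2=\mathbf{j}^2=-1$, and $\mathbb{C}(\mathbf{i})$ is the complex field with imaginary unit $\mathbf{i}$. Put $\mathbf{e_1}=\frac12(1+\mathbf{k})$, $\mathbf{e_2}=\frac12(1-\mathbf{k})$; these satisfy $\mathbf{e_1}+\mathbf{e_2}=1$, $\mathbf{e_1}\mathbf{e_2}=0$, $\mathbf{e_l}^2=\mathbf{e_l}$. Every $Z=Z_1+\mathbf{j}Z_2$ is written uniquely as $Z=\beta_1\mathbf{e_1}+\beta_2\mathbf{e_2}$ with $\beta_1=Z_1-\mathbf{i}Z_2$, $\beta_2=Z_1+\mathbf{i}Z_2$ in $\mathbb{C}(\mathbf{i})$; operations are componentwise in this representation. $\mathcal{O}_0=\mathcal{O}\cup\{0\}$, where $\mathcal{O}=\{Z=Z_1+\mathbf{j}Z_2\ne0: Z_1^2+Z_2^2=0\}$ is the set of zero divisors, so $Z\in\mathcal{O}_0$ iff $\beta_1=0$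 or $\beta_2=0$. The hyperbolic-valued norm is $|Z|_{\mathbf{k}}=|\beta_1|\mathbf{e_1}+|\beta_2|\mathbf{e_2}$. For $a=a_1\mathbf{e_1}+a_2\mathbf{e_2}$, $b=b_1\mathbf{e_1}+b_2\mathbf{e_2}$ with real $a_l,b_l$, $a\preceq b$ means $a_1\le b_1$ and $a_2\le b_2$, and $a\prec b$ means $a_1<b_1$ and $a_2<b_2$; real numbers $c$ are identified with $c\,\mathbf{e_1}+c\,\mathbf{e_2}$. A set $\Omega\subset\mathbb{BC}$ is product-type if $\Omega=\Omega_1\mathbf{e_1}+\Omega_2\mathbf{e_2}$ with $\Omega_1,\Omega_2\subset\mathbb{C}(\mathbf{i})$. A function $F:\Omega\to\mathbb{BC}$ is product-type if there are $F_l:\Omega_l\to\mathbb{C}(\mathbf{i})$ with $F(\beta_1\mathbf{e_1}+\beta_2\mathbf{e_2})=F_1(\beta_1)\mathbf{e_1}+F_2(\beta_2)\mathbf{e_2}$ on $\Omega$. $F$ is $\mathbb{BC}$-holomorphic on an open set $\Omega$ if for every $Z_0\in\Omega$ the limit of $\frac{F(Z)-F(Z_0)}{Z-Z_0}$ as $Z\to Z_0$ with $Z-Z_0\notin\mathcal{O}_0$ exists. $F$ is $\mathbb{BC}$-univalent on a product-type open set $\Omega$ if $F$ is product-type and $F(Z)\ne F(W)$ for all distinct $Z,W\in\Omega$. $\Delta=\{Z\in\mathbb{BC}:|Z|_{\mathbf{k}}\succ1\}$, i.e. $|\beta_1|>1$ and $|\beta_2|>1$. $\Sigma$ is the class of $\mathbb{BC}$-holomorphic,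 $\mathbb{BC}$-univalent functions $G:\Delta\to\mathbb{BC}$ having an expansion $G(Z)=Z+B_0+B_1Z^{-1}+B_2Z^{-2}+\cdots$ on $\Delta$ with coefficients $B_n\in\mathbb{BC}$. *)

theory Defs
  imports "HOL-Analysis.Analysis"
begin

section \<open>The algebra of bicomplex numbers\<close>

text \<open>\<open>BC Z\<^sub>1 Z\<^sub>2\<close> stands for \<open>Z\<^sub>1 + \<^bold>j Z\<^sub>2\<close>.\<close>

datatype bicomplex = BC (fst_BC: complex) (snd_BC: complex)

lemma bicomplex_eq_iff: "Z = W \<longleftrightarrow> fst_BC Z = fst_BC W \<and> snd_BC Z = snd_BC W"
  by (cases Z; cases W) simp

instantiation bicomplex :: comm_ring_1
begin

definition zero_bicomplex :: bicomplex where "0 = BC 0 0"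
definition one_bicomplex :: bicomplex where "1 = BC 1 0"
definition plus_bicomplex :: "bicomplex \<Rightarrow> bicomplex \<Rightarrow> bicomplex" where
  "Z + W = BC (fst_BC Z + fst_BC W) (snd_BC Z + snd_BC W)"
definition uminus_bicomplex :: "bicomplex \<Rightarrow> bicomplex" where
  "- Z = BC (- fst_BC Z) (- snd_BC Z)"
definition minus_bicomplex :: "bicomplex \<Rightarrow> bicomplex \<Rightarrow> bicomplex" where
  "Z - W = BC (fst_BC Z - fst_BC W) (snd_BC Z - snd_BC W)"
definition times_bicomplex :: "bicomplex \<Rightarrow> bicomplex \<Rightarrow> bicomplex" where
  "Z * W = BC (fst_BC Z * fst_BC W - snd_BC Z * snd_BC W)
              (fst_BC Z * snd_BC W + snd_BC Z * fst_BC W)"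

instance
  by standard
    (simp_all add: bicomplex_eq_iff zero_bicomplex_def one_bicomplex_def plus_bicomplex_def
      uminus_bicomplex_def minus_bicomplex_def times_bicomplex_def algebra_simps)

end

text \<open>
  \<open>(Z\<^sub>1 + \<^bold>j Z\<^sub>2) (Z\<^sub>1 - \<^bold>j Z\<^sub>2) = Z\<^sub>1\<^sup>2 + Z\<^sub>2\<^sup>2\<close>; this gives the inverse outside the zero divisors.
  On zero divisors and at \<open>0\<close> the value is the dummy \<open>0\<close>.
\<close>

instantiation bicomplex :: inverse
begin

definition inverse_bicomplex :: "bicomplex \<Rightarrow> bicomplex" where
  "inverse Z = BC (fst_BC Z / ((fst_BC Z)\<^sup>2 + (snd_BC Z)\<^sup>2))
                  (- snd_BC Z / ((fst_BC Z)\<^sup>2 + (snd_BC Z)\<^sup>2))"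
definition divide_bicomplex :: "bicomplex \<Rightarrow> bicomplex \<Rightarrow> bicomplex" where
  "Z div W = Z * inverse (W :: bicomplex)"

instance ..

end

instantiation bicomplex :: real_algebra_1
begin

definition scaleR_bicomplex :: "real \<Rightarrow> bicomplex \<Rightarrow> bicomplex" where
  "scaleR r Z = BC (scaleR r (fst_BC Z)) (scaleR r (snd_BC Z))"

instance
  by standard
    (simp_all add: bicomplex_eq_iff scaleR_bicomplex_def plus_bicomplex_def
      times_bicomplex_def algebra_simps)

end

text \<open>
  The topology is that of \<open>\<complex>\<^sup>2\<close>, given by the Euclidean norm (which is not submultiplicative).
\<close>

instantiation bicomplex :: real_normed_vector
begin

definition norm_bicomplex :: "bicomplex \<Rightarrow> real" where
  "norm Z = sqrt ((norm (fst_BC Z))\<^sup>2 + (norm (snd_BC Z))\<^sup>2)"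
definition sgn_bicomplex :: "bicomplex \<Rightarrow> bicomplex" where
  "sgn (Z :: bicomplex) = Z /\<^sub>R norm Z"
definition dist_bicomplex :: "bicomplex \<Rightarrow> bicomplex \<Rightarrow> real" where
  "dist Z W = norm (Z - W :: bicomplex)"
definition uniformity_bicomplex [code del]:
  "(uniformity :: (bicomplex \<times> bicomplex) filter)
     = (INF e\<in>{0<..}. principal {(x, y). dist x y < e})"
definition open_bicomplex [code del]:
  "open (U :: bicomplex set) \<longleftrightarrow>
     (\<forall>x\<in>U. eventually (\<lambda>(x', y). x' = x \<longrightarrow> y \<in> U) uniformity)"

instance
proof
  fix r :: real and x y :: bicomplex and S :: "bicomplex set"
  show "(norm x = 0) = (x = 0)"
    by (simp add: norm_bicomplex_def bicomplex_eq_iff zero_bicomplex_def)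
  have "norm (x + y) \<le> sqrt ((norm (fst_BC x) + norm (fst_BC y))\<^sup>2
                            + (norm (snd_BC x) + norm (snd_BC y))\<^sup>2)"
    unfolding norm_bicomplex_def plus_bicomplex_def bicomplex.sel
    by (intro real_sqrt_le_mono add_mono power_mono norm_triangle_ineq norm_ge_zero)
  also have "\<dots> \<le> norm x + norm y"
    unfolding norm_bicomplex_def by (rule real_sqrt_sum_squares_triangle_ineq)
  finally show "norm (x + y) \<le> norm x + norm y" .
  show "norm (scaleR r x) = \<bar>r\<bar> * norm x"
    by (simp add: norm_bicomplex_def scaleR_bicomplex_def power_mult_distrib real_sqrt_mult
        flip: distrib_left)
qed (rule sgn_bicomplex_def dist_bicomplex_def open_bicomplex uniformity_bicomplex)+

end

definition of_C :: "complex \<Rightarrow> bicomplex" where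
  "of_C z = BC z 0"

definition unit_i :: bicomplex where "unit_i = of_C \<i>"
definition unit_j :: bicomplex where "unit_j = BC 0 1"
definition unit_k :: bicomplex where "unit_k = unit_i * unit_j"

lemma BC_conv: "BC z w = of_C z + unit_j * of_C w"
  by (simp add: of_C_def unit_j_def plus_bicomplex_def times_bicomplex_def)

lemma unit_squares: "unit_i * unit_i = -1" "unit_j * unit_j = -1"
  by (simp_all add: unit_i_def unit_j_def of_C_def times_bicomplex_def uminus_bicomplex_def
      one_bicomplex_def)


section \<open>Idempotent representation and zero divisors\<close>

definition e1 :: bicomplex where "e1 = (1/2) *\<^sub>R (1 + unit_k)"
definition e2 :: bicomplex where "e2 = (1/2) *\<^sub>R (1 - unit_k)"

definition \<beta>\<^sub>1 :: "bicomplex \<Rightarrow> complex" where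
  "\<beta>\<^sub>1 Z = fst_BC Z - \<i> * snd_BC Z"
definition \<beta>\<^sub>2 :: "bicomplex \<Rightarrow> complex" where
  "\<beta>\<^sub>2 Z = fst_BC Z + \<i> * snd_BC Z"

lemmas bicomplex_unfold =
  zero_bicomplex_def one_bicomplex_def plus_bicomplex_def uminus_bicomplex_def
  minus_bicomplex_def times_bicomplex_def scaleR_bicomplex_def of_C_def
  unit_i_def unit_j_def unit_k_def e1_def e2_def \<beta>\<^sub>1_def \<beta>\<^sub>2_def

lemma idempotents: "e1 + e2 = 1" "e1 * e2 = 0" "e1 * e1 = e1" "e2 * e2 = e2"
  by (simp_all add: bicomplex_unfold scaleR_conv_of_real field_simps)

lemma beta_idempotent [simp]:
  "\<beta>\<^sub>1 (of_C z * e1 + of_C w * e2) = z" "\<beta>\<^sub>2 (of_C z * e1 + of_C w * e2) = w"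
  by (simp_all add: bicomplex_unfold scaleR_conv_of_real field_simps)

lemma idempotent_representation: "Z = of_C (\<beta>\<^sub>1 Z) * e1 + of_C (\<beta>\<^sub>2 Z) * e2"
  by (cases Z) (simp add: bicomplex_unfold scaleR_conv_of_real field_simps)

definition zero_divisors :: "bicomplex set" ("\<O>") where
  "\<O> = {Z. Z \<noteq> 0 \<and> (fst_BC Z)\<^sup>2 + (snd_BC Z)\<^sup>2 = 0}"

definition zero_divisors0 :: "bicomplex set" ("\<O>\<^sub>0") where
  "\<O>\<^sub>0 = \<O> \<union> {0}"

lemma beta_prod: "\<beta>\<^sub>1 Z * \<beta>\<^sub>2 Z = (fst_BC Z)\<^sup>2 + (snd_BC Z)\<^sup>2"
  by (simp add: \<beta>\<^sub>1_def \<beta>\<^sub>2_def power2_eq_square algebra_simps)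

lemma zero_divisors0_iff: "Z \<in> \<O>\<^sub>0 \<longleftrightarrow> \<beta>\<^sub>1 Z = 0 \<or> \<beta>\<^sub>2 Z = 0"
proof -
  have "Z \<in> \<O>\<^sub>0 \<longleftrightarrow> \<beta>\<^sub>1 Z * \<beta>\<^sub>2 Z = 0"
    by (auto simp: beta_prod zero_divisors_def zero_divisors0_def zero_bicomplex_def)
  then show ?thesis by simp
qed

lemma mult_inverse_bicomplex:
  assumes "Z \<notin> \<O>\<^sub>0"
  shows "Z * inverse Z = 1"
proof -
  obtain z w where Z: "Z = BC z w" by (cases Z)
  have "z\<^sup>2 + w\<^sup>2 \<noteq> 0"
    using assms by (auto simp: Z zero_divisors0_iff simp flip: beta_prod[of "BC z w", simplified])
  then show ?thesis
    by (simp add: Z inverse_bicomplex_def bicomplex_unfold power2_eq_square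
        add_divide_distrib [symmetric] algebra_simps)
qed


section \<open>Hyperbolic norm and order\<close>

definition hnorm :: "bicomplex \<Rightarrow> bicomplex" ("\<bar>_\<bar>\<^sub>k") where
  "\<bar>Z\<bar>\<^sub>k = norm (\<beta>\<^sub>1 Z) *\<^sub>R e1 + norm (\<beta>\<^sub>2 Z) *\<^sub>R e2"

text \<open>
  The relations hold only between hyperbolic numbers, i.e. real combinations of \<open>e1\<close> and \<open>e2\<close>.
  A real number \<open>c\<close> is \<open>c *\<^sub>R e1 + c *\<^sub>R e2\<close>; in particular \<open>1 = e1 + e2\<close>.
\<close>

definition hle :: "bicomplex \<Rightarrow> bicomplex \<Rightarrow> bool" (infix "\<preceq>" 50) where
  "a \<preceq> b \<longleftrightarrow> (\<exists>a1 a2 b1 b2 :: real.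
     a = a1 *\<^sub>R e1 + a2 *\<^sub>R e2 \<and> b = b1 *\<^sub>R e1 + b2 *\<^sub>R e2 \<and> a1 \<le> b1 \<and> a2 \<le> b2)"

definition hless :: "bicomplex \<Rightarrow> bicomplex \<Rightarrow> bool" (infix "\<prec>" 50) where
  "a \<prec> b \<longleftrightarrow> (\<exists>a1 a2 b1 b2 :: real.
     a = a1 *\<^sub>R e1 + a2 *\<^sub>R e2 \<and> b = b1 *\<^sub>R e1 + b2 *\<^sub>R e2 \<and> a1 < b1 \<and> a2 < b2)"

lemma beta_hyperbolic [simp]:
  "\<beta>\<^sub>1 (a *\<^sub>R e1 + b *\<^sub>R e2) = of_real a" "\<beta>\<^sub>2 (a *\<^sub>R e1 + b *\<^sub>R e2) = of_real b"
  by (simp_all add: bicomplex_unfold scaleR_conv_of_real field_simps)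


section \<open>Bicomplex functions\<close>

text \<open>A function from \<open>\<Omega>\<close> to the bicomplex numbers is a total function of which only the values on \<open>\<Omega>\<close> matter.\<close>

definition idem_set :: "complex set \<Rightarrow> complex set \<Rightarrow> bicomplex set" where
  "idem_set \<Omega>\<^sub>1 \<Omega>\<^sub>2 = {of_C z * e1 + of_C w * e2 | z w. z \<in> \<Omega>\<^sub>1 \<and> w \<in> \<Omega>\<^sub>2}"

definition product_type_set :: "bicomplex set \<Rightarrow> bool" where
  "product_type_set \<Omega> \<longleftrightarrow> (\<exists>\<Omega>\<^sub>1 \<Omega>\<^sub>2. \<Omega> = idem_set \<Omega>\<^sub>1 \<Omega>\<^sub>2)"

definition product_type_on :: "bicomplex set \<Rightarrow> (bicomplex \<Rightarrow> bicomplex) \<Rightarrow> bool" where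
  "product_type_on \<Omega> F \<longleftrightarrow> (\<exists>\<Omega>\<^sub>1 \<Omega>\<^sub>2 F\<^sub>1 F\<^sub>2. \<Omega> = idem_set \<Omega>\<^sub>1 \<Omega>\<^sub>2 \<and>
     (\<forall>z\<in>\<Omega>\<^sub>1. \<forall>w\<in>\<Omega>\<^sub>2. F (of_C z * e1 + of_C w * e2) = of_C (F\<^sub>1 z) * e1 + of_C (F\<^sub>2 w) * e2))"

definition bc_holomorphic_on :: "(bicomplex \<Rightarrow> bicomplex) \<Rightarrow> bicomplex set \<Rightarrow> bool" where
  "bc_holomorphic_on F \<Omega> \<longleftrightarrow> open \<Omega> \<and>
     (\<forall>Z\<^sub>0\<in>\<Omega>. \<exists>L. ((\<lambda>Z. (F Z - F Z\<^sub>0) / (Z - Z\<^sub>0)) \<longlongrightarrow> L)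
                 (at Z\<^sub>0 within {Z \<in> \<Omega>. Z - Z\<^sub>0 \<notin> \<O>\<^sub>0}))"

definition bc_univalent_on :: "(bicomplex \<Rightarrow> bicomplex) \<Rightarrow> bicomplex set \<Rightarrow> bool" where
  "bc_univalent_on F \<Omega> \<longleftrightarrow> open \<Omega> \<and> product_type_set \<Omega> \<and> product_type_on \<Omega> F \<and>
     (\<forall>Z\<in>\<Omega>. \<forall>W\<in>\<Omega>. Z \<noteq> W \<longrightarrow> F Z \<noteq> F W)"


section \<open>The class \<open>\<Sigma>\<close>\<close>

definition Delta :: "bicomplex set" where
  "Delta = {Z. 1 \<prec> \<bar>Z\<bar>\<^sub>k}"

definition has_expansion :: "(bicomplex \<Rightarrow> bicomplex) \<Rightarrow> (nat \<Rightarrow> bicomplex) \<Rightarrow> bool" where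
  "has_expansion G B \<longleftrightarrow>
     (\<forall>Z\<in>Delta. (\<lambda>n. B (Suc n) * inverse Z ^ Suc n) sums (G Z - (Z + B 0)))"

definition Sigma_class :: "(bicomplex \<Rightarrow> bicomplex) set" where
  "Sigma_class = {G. bc_holomorphic_on G Delta \<and> bc_univalent_on G Delta \<and> (\<exists>B. has_expansion G B)}"

lemma Delta_iff: "Z \<in> Delta \<longleftrightarrow> norm (\<beta>\<^sub>1 Z) > 1 \<and> norm (\<beta>\<^sub>2 Z) > 1"
proof
  assume "Z \<in> Delta"
  then obtain a1 a2 b1 b2 :: real where *: "1 = a1 *\<^sub>R e1 + a2 *\<^sub>R e2"
      "\<bar>Z\<bar>\<^sub>k = b1 *\<^sub>R e1 + b2 *\<^sub>R e2" "a1 < b1" "a2 < b2"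
    by (auto simp: Delta_def hless_def)
  have "\<beta>\<^sub>1 1 = of_real a1" "\<beta>\<^sub>2 1 = of_real a2" by (simp_all add: *(1))
  then have "a1 = 1" "a2 = 1"
    by (simp_all add: \<beta>\<^sub>1_def \<beta>\<^sub>2_def one_bicomplex_def)
  moreover have "\<beta>\<^sub>1 (\<bar>Z\<bar>\<^sub>k) = of_real b1" "\<beta>\<^sub>2 (\<bar>Z\<bar>\<^sub>k) = of_real b2" by (simp_all add: *(2))
  then have "b1 = norm (\<beta>\<^sub>1 Z)" "b2 = norm (\<beta>\<^sub>2 Z)"
    by (simp_all add: hnorm_def)
  ultimately show "norm (\<beta>\<^sub>1 Z) > 1 \<and> norm (\<beta>\<^sub>2 Z) > 1" using * by simp
next
  assume "norm (\<beta>\<^sub>1 Z) > 1 \<and> norm (\<beta>\<^sub>2 Z) > 1"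
  moreover have "1 = (1::real) *\<^sub>R e1 + (1::real) *\<^sub>R e2" by (simp add: idempotents)
  ultimately show "Z \<in> Delta"
    unfolding Delta_def hless_def hnorm_def by blast
qed

lemma product_type_Delta: "product_type_set Delta"
proof -
  have "Delta = idem_set {z. norm z > 1} {z. norm z > 1}"
  proof (intro equalityI subsetI)
    fix Z assume "Z \<in> Delta"
    then show "Z \<in> idem_set {z. norm z > 1} {z. norm z > 1}"
      unfolding idem_set_def Delta_iff using idempotent_representation[of Z] by blast
  qed (auto simp: idem_set_def Delta_iff)
  then show ?thesis unfolding product_type_set_def by blast
qed

lemma bounded_linear_BC: "bounded_linear fst_BC" "bounded_linear snd_BC"
  by (rule bounded_linear_intro[where K = 1];
      simp add: plus_bicomplex_def scaleR_bicomplex_def norm_bicomplex_def)+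

lemma open_Delta: "open Delta"
proof -
  have "continuous_on UNIV \<beta>\<^sub>1" "continuous_on UNIV \<beta>\<^sub>2"
    unfolding \<beta>\<^sub>1_def[abs_def] \<beta>\<^sub>2_def[abs_def]
    by (intro continuous_intros bounded_linear_BC[THEN bounded_linear.continuous_on])+
  then have "open ({Z. norm (\<beta>\<^sub>1 Z) > 1} \<inter> {Z. norm (\<beta>\<^sub>2 Z) > 1})"
    by (intro open_Int open_Collect_less continuous_intros)
  moreover have "Delta = {Z. norm (\<beta>\<^sub>1 Z) > 1} \<inter> {Z. norm (\<beta>\<^sub>2 Z) > 1}"
    by (auto simp: Delta_iff)
  ultimately show ?thesis by simp
qed

end

theory Submission
  imports Defs "HOL-Real_Asymp.Real_Asymp"
begin

text \<open>
  The idempotent coordinates \<open>\<beta>\<^sub>1\<close>, \<open>\<beta>\<^sub>2\<close> turn sums, products, inverses and limits of bicomplex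
  numbers into pairs of the same operations on complex numbers, and they turn \<open>\<preceq>\<close> into two real
  inequalities. A function of class \<open>\<Sigma>\<close> is a pair of injective functions
  \<open>g(z) = z + b\<^sub>0 + b\<^sub>1/z + b\<^sub>2/z\<^sup>2 + \<dots>\<close> on \<open>|z| > 1\<close> (injectivity passes to each factor by freezing the
  other variable), so the claim is Gronwall's area theorem \<open>\<Sum> n |b\<^sub>n|\<^sup>2 \<le> 1\<close> for both factors.

  The classical proof of Gronwall's theorem computes the area enclosed by the curve \<open>g(|z| = r)\<close>
  with Green's formula and observes that it is nonnegative. Here no Jordan curve is needed: the
  image of a whole annulus \<open>r < |z| < R\<close> is measured instead. By change of variables and
  orthogonality of the exponentials (\<open>Bessel_on_circle\<close>, \<open>area_lower_bound\<close>), the image has area at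
  least
  \<open>\<pi> (R\<^sup>2 - r\<^sup>2) + \<pi> \<Sum> n |b\<^sub>n|\<^sup>2 (r\<^sup>-\<^sup>2\<^sup>n - R\<^sup>-\<^sup>2\<^sup>n)\<close>, the sum running over any finite initial segment. If
  the image had area at most \<open>\<pi> R\<^sup>2 + o(1)\<close>, then \<open>R \<rightarrow> \<infinity>\<close> followed by \<open>r \<rightarrow> 1\<close> would finish the proof.

  The image of \<open>|z| = R\<close> is not close enough to a circle for this: on it
  \<open>b\<^sub>1/z\<close> equals \<open>k z\<^sup>*\<close> with \<open>k = b\<^sub>1/R\<^sup>2\<close> and \<open>z\<^sup>*\<close> the conjugate, so up to \<open>O(R\<^sup>-\<^sup>2)\<close> the image is an
  ellipse of semiaxes \<open>R \<plusminus> |b\<^sub>1|/R\<close>, and the area of a disc around it is too large by a constant. The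
  real-linear map \<open>w \<mapsto> w - k w\<^sup>*\<close> makes the ellipse round again: it maps the image of the annulus into
  a disc of radius \<open>R + O(R\<^sup>-\<^sup>2)\<close> (\<open>Laurent_image_in_disc\<close>), and its determinant \<open>1 - |k|\<^sup>2\<close> is
  \<open>1 - O(R\<^sup>-\<^sup>4)\<close>, which costs only \<open>O(R\<^sup>-\<^sup>2)\<close> in area. Both errors vanish in the limit.

  Polar coordinates enter through the logarithmic variable \<open>w = s + \<i> t\<close> with \<open>z = exp w\<close>; the annulus,
  slit along the positive real axis, is then an open rectangle of height \<open>2\<pi>\<close>.
\<close>

section \<open>Area of holomorphic images under a real-linear perturbation\<close>

text \<open>
  Change of variables with a Jacobian determinant is a theorem about \<open>real ^ 'n\<close>, so areas in the
  complex plane are transported to \<open>real ^ 2\<close>.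
\<close>

definition plane_of_complex :: "complex \<Rightarrow> real^2"
  where "plane_of_complex z = vector [Re z, Im z]"

definition complex_of_plane :: "real^2 \<Rightarrow> complex"
  where "complex_of_plane x = Complex (x$1) (x$2)"

lemma plane_of_complex_component [simp]:
  "plane_of_complex z $ 1 = Re z" "plane_of_complex z $ 2 = Im z"
  by (simp_all add: plane_of_complex_def)

lemma complex_of_plane_sel [simp]:
  "Re (complex_of_plane x) = x $ 1" "Im (complex_of_plane x) = x $ 2"
  by (simp_all add: complex_of_plane_def)

lemma complex_of_plane_of_complex [simp]: "complex_of_plane (plane_of_complex z) = z"
  by (simp add: complex_eq_iff)

lemma plane_of_complex_of_plane [simp]: "plane_of_complex (complex_of_plane x) = x"
  by (simp add: vec_eq_iff forall_2)

lemma norm_plane: "norm (x :: real^2) = sqrt ((x$1)\<^sup>2 + (x$2)\<^sup>2)"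
  by (simp add: norm_vec_def L2_set_def UNIV_2)

lemma bounded_linear_plane_of_complex: "bounded_linear plane_of_complex"
  by (rule bounded_linear_intro[where K = 1])
     (simp_all add: vec_eq_iff forall_2 norm_plane cmod_def)

lemma bounded_linear_complex_of_plane: "bounded_linear complex_of_plane"
  by (rule bounded_linear_intro[where K = 1])
     (simp_all add: complex_eq_iff norm_plane cmod_def)

lemma dist_plane_of_complex: "dist (plane_of_complex z) (plane_of_complex w) = dist z w"
  unfolding dist_norm by (simp add: norm_plane cmod_def)

text \<open>
  Multiplication by \<open>p\<close> scales areas by \<open>|p|\<^sup>2\<close>. The map \<open>w \<mapsto> w - k w\<^sup>*\<close> scales the two axes of an
  orthogonal frame by \<open>1 - |k|\<close> and \<open>1 + |k|\<close>, whence the factor \<open>1 - |k|\<^sup>2\<close>.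
\<close>

lemma det_conj_perturbation:
  "det (matrix (\<lambda>x. plane_of_complex (p * complex_of_plane x - k * cnj (p * complex_of_plane x))))
     = (1 - (norm k)\<^sup>2) * (norm p)\<^sup>2"
  unfolding det_2 matrix_def cmod_power2 by (simp add: axis_def algebra_simps power2_eq_square)

text \<open>
  Fubini's theorem holds on the product type \<open>real \<times> real\<close>; the obvious bijection with \<open>real ^ 2\<close>
  preserves boxes and their content, which transfers the integral.
\<close>

lemma integral_plane_eq_iterated:
  fixes f :: "complex \<Rightarrow> real"
  assumes cont: "continuous_on {w. Re w \<in> {a..b} \<and> Im w \<in> {c..d}} f"
  shows "((\<lambda>x. f (complex_of_plane x)) has_integral
            integral {a..b} (\<lambda>s. integral {c..d} (\<lambda>t. f (Complex s t))))
          (cbox (vector [a, c]) (vector [b, d]))"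
proof -
  let ?g = "\<lambda>x :: real^2. (x$1, x$2)" and ?h = "\<lambda>y :: real \<times> real. vector [fst y, snd y] :: real^2"
  let ?f = "\<lambda>y. f (Complex (fst y) (snd y))"
  have g: "?g ` cbox u v = cbox (?g u) (?g v)" for u v
  proof (intro equalityI subsetI)
    fix y assume "y \<in> cbox (?g u) (?g v)"
    then show "y \<in> ?g ` cbox u v"
      by (intro image_eqI[of _ _ "?h y"]) (cases y, auto simp: cbox_Pair_eq mem_box_cart forall_2)
  qed (auto simp: cbox_Pair_eq mem_box_cart forall_2)
  have h: "?h ` cbox u v = cbox (?h u) (?h v)" for u v
  proof (intro equalityI subsetI)
    fix x assume "x \<in> cbox (?h u) (?h v)"
    then show "x \<in> ?h ` cbox u v"
      by (cases u, cases v, intro image_eqI[of _ _ "?g x"])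
         (auto simp: cbox_Pair_eq mem_box_cart forall_2 vec_eq_iff)
  next
    fix x assume "x \<in> ?h ` cbox u v"
    then show "x \<in> cbox (?h u) (?h v)"
      by (cases u, cases v) (auto simp: cbox_Pair_eq mem_box_cart forall_2)
  qed
  have cf: "continuous_on (cbox (a, c) (b, d)) ?f"
  proof (rule continuous_on_compose2[OF cont])
    show "continuous_on (cbox (a, c) (b, d)) (\<lambda>y. Complex (fst y) (snd y))"
      unfolding Complex_eq by (intro continuous_intros)
  qed auto
  have "(?f has_integral integral (cbox (a, c) (b, d)) ?f) (cbox (a, c) (b, d))"
    using integrable_continuous[OF cf] by (rule integrable_integral)
  moreover have "measure lborel (?g ` cbox u v) = 1 * measure lborel (cbox u v)" for u v
  proof (cases "cbox u v = {}")
    case False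
    then have "u$1 \<le> v$1" "u$2 \<le> v$2" by (auto simp: interval_ne_empty_cart)
    then show ?thesis
      unfolding g using False by (simp add: content_Pair content_cbox_cart UNIV_2)
  qed simp
  ultimately have "((\<lambda>x. ?f (?g x)) has_integral (1/1) *\<^sub>R integral (cbox (a, c) (b, d)) ?f)
        (?h ` cbox (a, c) (b, d))"
    using g h
    by (intro has_integral_twiddle) (auto simp: vec_eq_iff forall_2 intro!: continuous_intros)
  then show ?thesis
    unfolding h integral_prod_continuous[OF cf] by (simp add: complex_of_plane_def)
qed

text \<open>
  The left-hand side is the area of the image of the rectangle under \<open>F\<close> followed by \<open>w \<mapsto> w - k w\<^sup>*\<close>.
  For \<open>|k| < 1\<close> the second map is injective, so that no part of the area is counted twice.
\<close>

lemma area_image_le: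
  fixes F \<phi> :: "complex \<Rightarrow> complex" and k q :: complex
  assumes der: "\<And>w. \<lbrakk>Re w \<in> {a<..<b}; Im w \<in> {c<..<d}\<rbrakk> \<Longrightarrow> (F has_field_derivative \<phi> w) (at w)"
    and cont: "continuous_on {w. Re w \<in> {a..b} \<and> Im w \<in> {c..d}} \<phi>"
    and inj: "inj_on F {w. Re w \<in> {a<..<b} \<and> Im w \<in> {c<..<d}}"
    and k: "norm k < 1"
    and im: "\<And>w. \<lbrakk>Re w \<in> {a<..<b}; Im w \<in> {c<..<d}\<rbrakk> \<Longrightarrow> F w - k * cnj (F w) \<in> cball q \<rho>"
    and \<rho>: "\<rho> \<ge> 0"
  shows "(1 - (norm k)\<^sup>2) * integral {a..b} (\<lambda>s. integral {c..d} (\<lambda>t. (norm (\<phi> (Complex s t)))\<^sup>2))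
           \<le> pi * \<rho>\<^sup>2"
proof -
  define S :: "(real^2) set" where "S = box (vector [a, c]) (vector [b, d])"
  have S_iff: "x \<in> S \<longleftrightarrow> Re (complex_of_plane x) \<in> {a<..<b} \<and> Im (complex_of_plane x) \<in> {c<..<d}" for x
    by (auto simp: S_def mem_box_cart forall_2)
  define f where "f = (\<lambda>x. plane_of_complex (F (complex_of_plane x) - k * cnj (F (complex_of_plane x))))"
  define f' where "f' = (\<lambda>x h. plane_of_complex
    (\<phi> (complex_of_plane x) * complex_of_plane h - k * cnj (\<phi> (complex_of_plane x) * complex_of_plane h)))"
  have jac: "\<bar>det (matrix (f' x))\<bar> = (1 - (norm k)\<^sup>2) * (norm (\<phi> (complex_of_plane x)))\<^sup>2" for x
  proof -
    have "(norm k)\<^sup>2 \<le> 1" using k by (simp add: power_le_one)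
    then show ?thesis unfolding f'_def det_conj_perturbation by simp
  qed
  have der_f: "(f has_derivative f' x) (at x within S)" if "x \<in> S" for x
  proof -
    have "(F has_derivative (*) (\<phi> (complex_of_plane x))) (at (complex_of_plane x))"
      using der that by (simp add: S_iff has_field_derivative_def)
    then have "((\<lambda>x. F (complex_of_plane x)) has_derivative
             (\<lambda>h. \<phi> (complex_of_plane x) * complex_of_plane h)) (at x within S)"
      by (rule has_derivative_compose[rotated])
         (rule bounded_linear_imp_has_derivative[OF bounded_linear_complex_of_plane])
    then show ?thesis
      unfolding f_def f'_def
      by (intro bounded_linear.has_derivative[OF bounded_linear_plane_of_complex] has_derivative_diff
         has_derivative_mult_right bounded_linear.has_derivative[OF bounded_linear_cnj])
  qed
  have injA: "u = v" if "u - k * cnj u = v - k * cnj v" for u v :: complex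
  proof (rule ccontr)
    assume "u \<noteq> v"
    have "u - v = k * cnj (u - v)" using that by (simp add: algebra_simps)
    then have "norm (u - v) = norm k * norm (u - v)" by (metis complex_mod_cnj norm_mult)
    with \<open>u \<noteq> v\<close> k show False by simp
  qed
  have inj_f: "inj_on f S"
  proof (rule inj_onI)
    fix x y assume xy: "x \<in> S" "y \<in> S" "f x = f y"
    from xy(3) have "complex_of_plane (f x) = complex_of_plane (f y)" by (rule arg_cong)
    then have "F (complex_of_plane x) = F (complex_of_plane y)"
      unfolding f_def complex_of_plane_of_complex by (rule injA)
    then have "complex_of_plane x = complex_of_plane y"
      by (rule inj_onD[OF inj]) (use xy S_iff in simp_all)
    then show "x = y" by (metis plane_of_complex_of_plane)
  qed
  have "continuous_on {w. Re w \<in> {a..b} \<and> Im w \<in> {c..d}} (\<lambda>w. (1 - (norm k)\<^sup>2) * (norm (\<phi> w))\<^sup>2)"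
    using cont by (intro continuous_intros)
  from integral_plane_eq_iterated[OF this]
  have int: "((\<lambda>x. \<bar>det (matrix (f' x))\<bar>) has_integral
         (1 - (norm k)\<^sup>2) * integral {a..b} (\<lambda>s. integral {c..d} (\<lambda>t. (norm (\<phi> (Complex s t)))\<^sup>2))) S"
    unfolding jac S_def by (simp add: has_integral_open_interval)
  have S: "S \<in> sets lebesgue" by (simp add: S_def)
  have "measure lebesgue (f ` S) = integral S (\<lambda>x. \<bar>det (matrix (f' x))\<bar>)"
    using int by (intro measure_differentiable_image_eq S der_f inj_f) auto
  also have "\<dots> = (1 - (norm k)\<^sup>2) * integral {a..b} (\<lambda>s. integral {c..d} (\<lambda>t. (norm (\<phi> (Complex s t)))\<^sup>2))"
    using int by (rule integral_unique)
  finally have 1: "measure lebesgue (f ` S) = \<dots>" .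
  have "f ` S \<in> lmeasurable"
    using int measurable_differentiable_image_eq[OF S der_f inj_f] by auto
  moreover have "f ` S \<subseteq> cball (plane_of_complex q) \<rho>"
    using im by (auto simp: f_def S_iff dist_plane_of_complex)
  ultimately have "measure lebesgue (f ` S) \<le> measure lebesgue (cball (plane_of_complex q) \<rho>)"
    by (intro measure_mono_fmeasurable) (auto simp: fmeasurableD)
  also have "\<dots> = pi * \<rho>\<^sup>2"
    using \<rho> by (simp add: content_cball unit_ball_vol_2)
  finally show ?thesis using 1 by simp
qed

section \<open>Orthogonality of exponentials and the lower bound for the area\<close>

lemma has_integral_cis_int:
  "((\<lambda>t. cis (of_int k * t)) has_integral (if k = 0 then 2 * pi else 0)) {0..2 * pi}"
proof (cases "k = 0")
  case True
  then show ?thesis using has_integral_const_real[of "1::complex" 0 "2*pi"] 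
    by (simp add: scaleR_conv_of_real)
next
  case False
  have "((\<lambda>t. cis (of_int k * t)) has_integral
           (cis (of_int k * (2 * pi)) / (\<i> * of_int k) - cis (of_int k * 0) / (\<i> * of_int k))) {0..2 * pi}"
  proof (rule fundamental_theorem_of_calculus)
    fix t :: real
    have "((\<lambda>t. exp (\<i> * of_int k * t) / (\<i> * of_int k)) has_vector_derivative exp (\<i> * of_int k * t)) 
        (at t within {0..2 * pi})"
      using False
      by (intro has_vector_derivative_real_field)
        (auto intro!: derivative_eq_intros)
    then show "((\<lambda>t. cis (of_int k * t) / (\<i> * of_int k)) has_vector_derivative cis (of_int k * t))
        (at t within {0..2 * pi})"
      by (simp add: cis_conv_exp mult_ac)
  qed simp
  moreover have "cis (of_int k * (2 * pi)) = 1"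
    by (metis cis_multiple_2pi Ints_of_int mult.commute mult.left_commute)
  ultimately show ?thesis using False by simp
qed

text \<open>
  Parseval's identity for a trigonometric polynomial. The index set and the frequency map \<open>m\<close> are
  kept apart because the sums of interest are indexed by naturals but have frequencies
  \<open>1, -1, -2, \<dots>\<close>.
\<close>

lemma has_integral_norm_trig_polynomial:
  fixes c :: "'i \<Rightarrow> complex" and m :: "'i \<Rightarrow> int"
  assumes K: "finite K" and m: "inj_on m K"
  shows "((\<lambda>t. (norm (\<Sum>k\<in>K. c k * cis (of_int (m k) * t)))\<^sup>2) has_integral
            2 * pi * (\<Sum>k\<in>K. (norm (c k))\<^sup>2)) {0..2 * pi}"
proof -
  have eq: "complex_of_real ((norm (\<Sum>k\<in>K. c k * cis (of_int (m k) * t)))\<^sup>2)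
          = (\<Sum>k\<in>K. \<Sum>l\<in>K. c k * cnj (c l) * cis (of_int (m k - m l) * t))" for t
  proof -
    have "c k * cis (of_int (m k) * t) * cnj (c l * cis (of_int (m l) * t))
        = c k * cnj (c l) * cis (of_int (m k - m l) * t)" for k l
    proof -
      have "cis (of_int (m k - m l) * t) = cis (of_int (m k) * t) * cis (- (of_int (m l) * t))"
        by (simp add: cis_mult left_diff_distrib)
      then show ?thesis by (simp add: cis_cnj)
    qed
    then show ?thesis
      unfolding complex_norm_square cnj_sum sum_product by (intro sum.cong refl)
  qed
  have "((\<lambda>t. \<Sum>k\<in>K. \<Sum>l\<in>K. c k * cnj (c l) * cis (of_int (m k - m l) * t)) has_integral
          (\<Sum>k\<in>K. \<Sum>l\<in>K. c k * cnj (c l) * (if m k - m l = 0 then 2 * pi else 0))) {0..2 * pi}"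
    by (intro has_integral_sum has_integral_mult_right K has_integral_cis_int)
  also have "(\<Sum>k\<in>K. \<Sum>l\<in>K. c k * cnj (c l) * (if m k - m l = 0 then 2 * pi else 0))
      = (\<Sum>k\<in>K. \<Sum>l\<in>K. if k = l then c k * cnj (c l) * (2 * pi) else 0)"
    using m by (intro sum.cong refl) (auto dest: inj_onD)
  also have "\<dots> = complex_of_real (2 * pi * (\<Sum>k\<in>K. (norm (c k))\<^sup>2))"
    using K by (simp add: sum_distrib_left complex_norm_square mult_ac del: of_real_power)
  finally have "((\<lambda>t. complex_of_real ((norm (\<Sum>k\<in>K. c k * cis (of_int (m k) * t)))\<^sup>2)) has_integral
      complex_of_real (2 * pi * (\<Sum>k\<in>K. (norm (c k))\<^sup>2))) {0..2 * pi}"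
    unfolding eq .
  from has_integral_linear[OF this bounded_linear_Re] show ?thesis
    by (simp only: o_def Re_complex_of_real)
qed

lemma exp_Complex: "exp (Complex s t) = of_real (exp s) * cis t"
  by (simp add: exp_eq_polar)

text \<open>
  The integrand is \<open>|e\<^sup>w - c\<^sub>0 e\<^sup>-\<^sup>w - c\<^sub>1 e\<^sup>-\<^sup>2\<^sup>w - \<dots>|\<^sup>2\<close> at \<open>w = s + \<i> t\<close>. For every partial sum with
  at least \<open>N\<close> terms, Parseval's identity bounds the integral from below by the first \<open>N\<close> squares; the partial sums converge
  boundedly, so that the bound survives in the limit.
\<close>

lemma Bessel_on_circle:
  fixes c :: "nat \<Rightarrow> complex"
  assumes conv: "\<And>x. norm x < 1 \<Longrightarrow> summable (\<lambda>n. c n * x ^ n)" and s: "s > 0"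
  shows "2 * pi * (exp (2 * s) + (\<Sum>n<N. (norm (c n))\<^sup>2 * exp (- (2 * real (Suc n) * s))))
      \<le> integral {0..2 * pi} (\<lambda>t. (norm (exp (Complex s t)
             - exp (- Complex s t) * (\<Sum>n. c n * exp (- Complex s t) ^ n)))\<^sup>2)"
proof -
  \<comment> \<open>Index \<open>0\<close> stands for the leading term \<open>e\<^sup>w\<close>, and index \<open>n + 1\<close> for the term with coefficient \<open>c n\<close>.\<close>
  define m :: "nat \<Rightarrow> int" where "m = (\<lambda>n. if n = 0 then 1 else - int n)"
  define a :: "nat \<Rightarrow> complex"
    where "a = (\<lambda>n. if n = 0 then of_real (exp s) else - c (n - 1) * of_real (exp (- s * n)))"
  define \<phi> where "\<phi> = (\<lambda>t. exp (Complex s t) - exp (- Complex s t) * (\<Sum>n. c n * exp (- Complex s t) ^ n))"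
  define P where "P = (\<lambda>M t. \<Sum>n<Suc M. a n * cis (of_int (m n) * t))"
  have E: "exp (- Complex s t) = of_real (exp (- s)) * cis (- t)" for t
    using exp_Complex[of "- s" "- t"] by (simp add: Complex_eq)
  have P_eq: "P M t = exp (Complex s t) - exp (- Complex s t) * (\<Sum>n<M. c n * exp (- Complex s t) ^ n)" for M t
  proof -
    have "of_real (exp (- s * Suc n)) * cis (of_int (m (Suc n)) * t) = exp (- Complex s t) ^ Suc n" for n
    proof -
      have "exp (- Complex s t) ^ Suc n = of_real (exp (- s) ^ Suc n) * cis (- t) ^ Suc n"
        by (simp only: E power_mult_distrib of_real_power)
      moreover have "exp (- s) ^ Suc n = exp (- s * Suc n)"
        by (simp only: exp_of_nat_mult[symmetric] mult.commute)
      moreover have "cis (- t) ^ Suc n = cis (of_int (m (Suc n)) * t)"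
        unfolding Complex.DeMoivre by (simp add: m_def algebra_simps)
      ultimately show ?thesis by (simp only:)
    qed
    then have "a (Suc n) * cis (of_int (m (Suc n)) * t) = - (exp (- Complex s t) * (c n * exp (- Complex s t) ^ n))" for n
      by (simp add: a_def mult_ac)
    then show ?thesis
      unfolding P_def sum.lessThan_Suc_shift
      by (simp only:) (simp add: sum_negf sum_distrib_left exp_Complex a_def m_def)
  qed
  have norm_E: "norm (exp (- Complex s t)) = exp (- s)" for t
    by simp
  \<comment> \<open>A radius strictly between \<open>e\<^sup>-\<^sup>s\<close> and \<open>1\<close> gives absolute convergence at \<open>e\<^sup>-\<^sup>s\<close>.\<close>
  have "exp (- s) < 1" using s by simp
  then obtain x where x: "exp (- s) < x" "x < 1" using dense by blast
  then have "0 < x" by (meson exp_gt_zero less_trans)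
  then have "summable (\<lambda>n. c n * of_real x ^ n)" using x by (intro conv) simp
  then have abs: "summable (\<lambda>n. norm (c n * of_real (exp (- s)) ^ n))"
    by (rule powser_insidea) (use x \<open>0 < x\<close> in simp)
  define B where "B = exp s + exp (- s) * (\<Sum>n. norm (c n * of_real (exp (- s)) ^ n))"
  have P_bound: "norm (P M t) \<le> B" for M t
  proof -
    have "norm (\<Sum>n<M. c n * exp (- Complex s t) ^ n) \<le> (\<Sum>n<M. norm (c n * of_real (exp (- s)) ^ n))"
      by (rule sum_norm_le) (simp add: norm_mult norm_power)
    also have "\<dots> \<le> (\<Sum>n. norm (c n * of_real (exp (- s)) ^ n))"
      using abs by (intro sum_le_suminf) auto
    finally have "norm (exp (- Complex s t) * (\<Sum>n<M. c n * exp (- Complex s t) ^ n))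
        \<le> exp (- s) * (\<Sum>n. norm (c n * of_real (exp (- s)) ^ n))"
      unfolding norm_mult norm_E by (intro mult_left_mono) auto
    then show ?thesis
      unfolding P_eq B_def by (intro norm_triangle_le_diff add_mono) auto
  qed
  have P_lim: "(\<lambda>M. P M t) \<longlonglongrightarrow> \<phi> t" for t
    unfolding P_eq \<phi>_def using s
    by (intro tendsto_intros summable_LIMSEQ conv) simp
  have P_int: "((\<lambda>t. (norm (P M t))\<^sup>2) has_integral 2 * pi * (\<Sum>n<Suc M. (norm (a n))\<^sup>2)) {0..2 * pi}" for M
    unfolding P_def by (rule has_integral_norm_trig_polynomial) (auto simp: m_def inj_on_def)
  have lim: "(\<lambda>M. integral {0..2 * pi} (\<lambda>t. (norm (P M t))\<^sup>2))
        \<longlonglongrightarrow> integral {0..2 * pi} (\<lambda>t. (norm (\<phi> t))\<^sup>2)"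
  proof (rule dominated_convergence(2)[where h = "\<lambda>_. B\<^sup>2"])
    show "norm ((norm (P M t))\<^sup>2) \<le> B\<^sup>2" for M t
      using power_mono[OF P_bound norm_ge_zero, of M t 2] by simp
  qed (use P_int P_lim in \<open>auto intro!: tendsto_intros\<close>)
  have a_sq: "(norm (a (Suc n)))\<^sup>2 = (norm (c n))\<^sup>2 * exp (- (2 * real (Suc n) * s))" for n
    by (simp add: a_def norm_mult power_mult_distrib power2_eq_square exp_add[symmetric] algebra_simps)
  have a_0: "(norm (a 0))\<^sup>2 = exp (2 * s)"
    by (simp add: a_def power2_eq_square exp_add[symmetric])
  have "2 * pi * (\<Sum>n<Suc N. (norm (a n))\<^sup>2) \<le> integral {0..2 * pi} (\<lambda>t. (norm (P M t))\<^sup>2)" if "N \<le> M" for M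
    unfolding integral_unique[OF P_int] using that by (intro mult_left_mono sum_mono2) auto
  then have "2 * pi * (\<Sum>n<Suc N. (norm (a n))\<^sup>2) \<le> integral {0..2 * pi} (\<lambda>t. (norm (\<phi> t))\<^sup>2)"
    by (intro tendsto_lowerbound[OF lim] eventually_sequentiallyI[of N]) auto
  then show ?thesis
    unfolding sum.lessThan_Suc_shift a_sq a_0 \<phi>_def .
qed

text \<open>
  Here \<open>\<phi>\<close> is the derivative of \<open>exp w + \<Sum> b\<^sub>n exp (- n w)\<close>, the function \<open>g\<close> in the logarithmic
  variable. Integrating Bessel's inequality over \<open>s\<close> turns the coefficients \<open>(n + 1)\<^sup>2 |b\<^sub>n\<^sub>+\<^sub>1|\<^sup>2\<close> into
  \<open>(n + 1) |b\<^sub>n\<^sub>+\<^sub>1|\<^sup>2\<close>: one factor is cancelled by the exponent.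
\<close>

lemma area_lower_bound:
  fixes b :: "nat \<Rightarrow> complex" and \<phi> :: "complex \<Rightarrow> complex"
  defines "\<phi> \<equiv> \<lambda>w. exp w - exp (- w) * (\<Sum>n. diffs b n * exp (- w) ^ n)"
  assumes conv: "\<And>x. norm x < 1 \<Longrightarrow> summable (\<lambda>n. diffs b n * x ^ n)"
    and cont: "continuous_on {w. Re w > 0} \<phi>"
    and ab: "0 < \<alpha>" "\<alpha> \<le> \<beta>"
  shows "pi * (exp (2 * \<beta>) - exp (2 * \<alpha>) + (\<Sum>n<N. real (Suc n) * (norm (b (Suc n)))\<^sup>2 *
             (exp (- (2 * real (Suc n) * \<alpha>)) - exp (- (2 * real (Suc n) * \<beta>)))))
      \<le> integral {\<alpha>..\<beta>} (\<lambda>s. integral {0..2 * pi} (\<lambda>t. (norm (\<phi> (Complex s t)))\<^sup>2))"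
proof -
  let ?l = "\<lambda>s. 2 * pi * (exp (2 * s) + (\<Sum>n<N. (norm (diffs b n))\<^sup>2 * exp (- (2 * real (Suc n) * s))))"
  let ?L = "\<lambda>s. pi * (exp (2 * s) - (\<Sum>n<N. real (Suc n) * (norm (b (Suc n)))\<^sup>2 * exp (- (2 * real (Suc n) * s))))"
  have d: "(norm (diffs b n))\<^sup>2 = (real (Suc n))\<^sup>2 * (norm (b (Suc n)))\<^sup>2" for n
    by (simp add: diffs_def norm_mult power_mult_distrib del: of_nat_Suc)
  have "(?L has_real_derivative ?l s) (at s within {\<alpha>..\<beta>})" for s
    unfolding d
    by (auto intro!: derivative_eq_intros simp: sum_distrib_left sum_negf algebra_simps power2_eq_square simp del: of_nat_Suc)
  then have "(?l has_integral (?L \<beta> - ?L \<alpha>)) {\<alpha>..\<beta>}"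
    using ab by (intro fundamental_theorem_of_calculus) (auto simp: has_real_derivative_iff_has_vector_derivative)
  moreover have "((\<lambda>s. integral {0..2 * pi} (\<lambda>t. (norm (\<phi> (Complex s t)))\<^sup>2)) has_integral
      integral {\<alpha>..\<beta>} (\<lambda>s. integral {0..2 * pi} (\<lambda>t. (norm (\<phi> (Complex s t)))\<^sup>2))) {\<alpha>..\<beta>}"
  proof -
    have "continuous_on (cbox (\<alpha>, 0) (\<beta>, 2 * pi)) (\<lambda>y. (norm (\<phi> (Complex (fst y) (snd y))))\<^sup>2)"
    proof (intro continuous_on_power continuous_on_norm, rule continuous_on_compose2[OF cont])
      show "continuous_on (cbox (\<alpha>, 0) (\<beta>, 2 * pi)) (\<lambda>y. Complex (fst y) (snd y))"
        unfolding Complex_eq by (intro continuous_intros)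
    qed (use ab in \<open>auto simp: cbox_Pair_eq\<close>)
    from integral_integrable_2dim[OF this] show ?thesis
      by (simp add: integrable_integral)
  qed
  moreover have "?l s \<le> integral {0..2 * pi} (\<lambda>t. (norm (\<phi> (Complex s t)))\<^sup>2)" if "s \<in> {\<alpha>..\<beta>}" for s
    unfolding \<phi>_def using that ab by (intro Bessel_on_circle conv) auto
  ultimately have "?L \<beta> - ?L \<alpha> \<le> integral {\<alpha>..\<beta>} (\<lambda>s. integral {0..2 * pi} (\<lambda>t. (norm (\<phi> (Complex s t)))\<^sup>2))"
    by (rule has_integral_le)
  then show ?thesis
    by (simp add: algebra_simps sum_subtractf)
qed

section \<open>The image of an annulus lies in a disc\<close>

text \<open>
  Write \<open>\<rho> = |z|\<close>. Since \<open>z\<^sup>* = \<rho>\<^sup>2/z\<close>, subtracting \<open>k g\<^sup>*\<close> with \<open>k = b\<^sub>1/R\<^sup>2\<close> turns \<open>b\<^sub>1/z\<close> into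
  \<open>(b\<^sub>1/z) (1 - \<rho>\<^sup>2/R\<^sup>2)\<close>, which vanishes on the outer circle and in general is at most \<open>R - \<rho>\<close>
  in modulus once \<open>R\<close> is large and \<open>\<rho> \<ge> R/2\<close>; the remaining terms are then \<open>O(R\<^sup>-\<^sup>2)\<close>. For
  \<open>\<rho> < R/2\<close> the terms other than \<open>z\<close> and the constant are bounded, and \<open>\<rho>\<close> leaves a margin of
  \<open>R/2\<close> to accommodate them.
\<close>

lemma Laurent_image_in_disc:
  fixes b :: "nat \<Rightarrow> complex" and r :: real
  assumes conv: "\<And>x. norm x < 1 \<Longrightarrow> summable (\<lambda>n. b n * x ^ n)" and r: "r > 1"
  defines "k \<equiv> \<lambda>R::real. b 1 / of_real (R\<^sup>2)"
  defines "g \<equiv> \<lambda>z. z + (\<Sum>n. b n * inverse z ^ n)"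
  obtains C where "C \<ge> 0"
    and "\<forall>\<^sub>F R in at_top. \<forall>z. r \<le> norm z \<and> norm z \<le> R \<longrightarrow>
           g z - k R * cnj (g z) \<in> cball (b 0 - k R * cnj (b 0)) (R + C / R\<^sup>2)"
proof -
  define c where "c = norm (b 1)"
  have c0: "c \<ge> 0" by (simp add: c_def)
  have "inverse r < 1" using r by (simp add: inverse_less_1_iff)
  then obtain x where x: "inverse r < x" "x < 1" using dense by blast
  moreover have "0 < inverse r" using r by simp
  ultimately have "0 < x" by linarith
  then have "summable (\<lambda>n. b n * of_real x ^ n)" using x by (intro conv) simp
  then have "summable (\<lambda>n. norm (b n * of_real (inverse r) ^ n))"
    by (rule powser_insidea) (use x \<open>0 < x\<close> r in \<open>simp add: norm_inverse\<close>)
  then have "summable (\<lambda>n. norm (b n) * inverse r ^ n)"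
    using r by (simp add: norm_mult norm_power norm_inverse)
  then have "summable (\<lambda>n. norm (b (n + 2)) * inverse r ^ (n + 2))"
    by (rule summable_ignore_initial_segment)
  then have "summable (\<lambda>n. r\<^sup>2 * (norm (b (n + 2)) * inverse r ^ (n + 2)))"
    by (rule summable_mult)
  then have E_sum: "summable (\<lambda>n. norm (b (n + 2)) * inverse r ^ n)"
    using r by (simp add: power_add field_simps power2_eq_square)
  define E where "E = (\<Sum>n. norm (b (n + 2)) * inverse r ^ n)"
  have E0: "E \<ge> 0" unfolding E_def using r by (intro suminf_nonneg E_sum) simp
  \<comment> \<open>\<open>E\<close> bounds the Laurent tail from \<open>b 2\<close> on, uniformly in \<open>norm z \<ge> r\<close>, after a factor \<open>z\<^sup>-\<^sup>2\<close> is split off.\<close>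
  have expand: "\<exists>e. g z = z + b 0 + b 1 / z + e \<and> norm e \<le> E / (norm z)\<^sup>2" if z: "r \<le> norm z" for z
  proof -
    have z1: "norm (inverse z) < 1" "z \<noteq> 0" using z r by (auto simp: norm_inverse inverse_less_1_iff)
    have "(\<Sum>n. b n * inverse z ^ n) = (\<Sum>n. b (n + 2) * inverse z ^ (n + 2)) + (\<Sum>n<2. b n * inverse z ^ n)"
      by (rule suminf_split_initial_segment[OF conv[OF z1(1)]])
    then have "g z = z + b 0 + b 1 / z + (\<Sum>n. b (n + 2) * inverse z ^ (n + 2))"
      by (simp add: g_def numeral_2_eq_2 divide_inverse)
    moreover have "norm (\<Sum>n. b (n + 2) * inverse z ^ (n + 2)) \<le> (\<Sum>n. norm (b (n + 2)) * inverse r ^ n * (inverse (norm z))\<^sup>2)"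
    proof (rule norm_suminf_le)
      show "norm (b (n + 2) * inverse z ^ (n + 2)) \<le> norm (b (n + 2)) * inverse r ^ n * (inverse (norm z))\<^sup>2" for n
        unfolding norm_mult norm_power norm_inverse power_add mult.assoc
        using z r by (intro mult_left_mono mult_right_mono power_mono le_imp_inverse_le) auto
    qed (rule summable_mult2[OF E_sum])
    moreover have "(\<Sum>n. norm (b (n + 2)) * inverse r ^ n * (inverse (norm z))\<^sup>2) = E / (norm z)\<^sup>2"
      unfolding E_def suminf_mult2[OF E_sum, symmetric] by (simp add: divide_inverse power_inverse)
    ultimately show ?thesis by metis
  qed
  \<comment> \<open>\<open>C\<close> collects the \<open>O(R\<^sup>-\<^sup>2)\<close> terms for \<open>norm z \<ge> R / 2\<close>: there \<open>1 / (norm z)\<^sup>2 \<le> 4 / R\<^sup>2\<close>, hence the factor 4.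
    \<open>c + q\<close> bounds all terms other than \<open>z\<close> and the constant for \<open>norm z < R / 2\<close>, so \<open>R \<ge> 2 * (c + q)\<close> is required.\<close>
  define C where "C = c\<^sup>2 + 4 * E * (1 + c)"
  define q where "q = c\<^sup>2 + E * (1 + c)"
  have q0: "q \<ge> 0" using c0 E0 by (simp add: q_def)
  define R0 where "R0 = 2 + 2 * c + 2 * (c + q)"
  have main: "g z - k R * cnj (g z) \<in> cball (b 0 - k R * cnj (b 0)) (R + C / R\<^sup>2)"
    if R: "R \<ge> R0" and z: "r \<le> norm z" "norm z \<le> R" for R z
  proof -
    define \<rho> where "\<rho> = norm z"
    have \<rho>: "1 < \<rho>" "\<rho> \<le> R" "z \<noteq> 0" using z r by (auto simp: \<rho>_def)
    have R1: "R \<ge> 2" "R \<ge> 2 * c" "R \<ge> 2 * (c + q)" "R > 0"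
      using R c0 q0 by (auto simp: R0_def)
    obtain e where e: "g z = z + b 0 + b 1 / z + e" "norm e \<le> E / \<rho>\<^sup>2"
      using expand[OF z(1)] unfolding \<rho>_def by blast
    have nk: "norm (k R) = c / R\<^sup>2" by (simp add: k_def c_def norm_divide norm_power)
    have cz: "cnj z = of_real (\<rho>\<^sup>2) / z"
      using \<rho>(3) complex_norm_square[of z] by (simp add: \<rho>_def field_simps)
    have "g z - k R * cnj (g z) - (b 0 - k R * cnj (b 0))
        = z + (b 1 / z) * of_real (1 - \<rho>\<^sup>2 / R\<^sup>2) + (- k R * cnj (b 1 / z)) + (e - k R * cnj e)"
      unfolding e(1) complex_cnj_add cz using R1 \<rho>(3) by (simp add: k_def field_simps)
    also have "norm \<dots> \<le> norm z + norm ((b 1 / z) * of_real (1 - \<rho>\<^sup>2 / R\<^sup>2)) + norm (k R * cnj (b 1 / z)) + (norm e + norm (k R * cnj e))"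
      by (intro norm_triangle_le add_mono norm_triangle_ineq4) auto
    also have "norm ((b 1 / z) * of_real (1 - \<rho>\<^sup>2 / R\<^sup>2)) = c / \<rho> * (1 - \<rho>\<^sup>2 / R\<^sup>2)"
    proof -
      have "\<rho>\<^sup>2 / R\<^sup>2 \<le> 1" using \<rho> by (simp add: power_mono)
      then show ?thesis by (simp add: norm_mult norm_divide c_def \<rho>_def del: of_real_diff of_real_divide)
    qed
    also have "norm (k R * cnj (b 1 / z)) = c\<^sup>2 / (\<rho> * R\<^sup>2)"
      by (simp add: norm_mult nk norm_divide c_def \<rho>_def power2_eq_square)
    also have "norm (k R * cnj e) = c / R\<^sup>2 * norm e"
      by (simp add: norm_mult nk)
    also have "norm z + c / \<rho> * (1 - \<rho>\<^sup>2 / R\<^sup>2) + c\<^sup>2 / (\<rho> * R\<^sup>2) + (norm e + c / R\<^sup>2 * norm e) \<le> R + C / R\<^sup>2"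
    proof -
      have "1 \<le> R\<^sup>2" using R1 by (simp add: one_le_power)
      then have "c / R\<^sup>2 \<le> c" using c0 by (simp add: divide_le_eq mult_le_cancel_left1)
      then have "c / R\<^sup>2 * norm e \<le> c * norm e" by (intro mult_right_mono) auto
      then have e2: "norm e + c / R\<^sup>2 * norm e \<le> (1 + c) * norm e" by (simp add: algebra_simps)
      also have "\<dots> \<le> (1 + c) * (E / \<rho>\<^sup>2)" using c0 e(2) by (intro mult_left_mono) auto
      finally have e3: "norm e + c / R\<^sup>2 * norm e \<le> (1 + c) * (E / \<rho>\<^sup>2)" .
      have t3: "c\<^sup>2 / (\<rho> * R\<^sup>2) \<le> c\<^sup>2 / R\<^sup>2"
        using \<rho> R1 by (intro divide_left_mono) auto
      show ?thesis
      proof (cases "\<rho> \<ge> R / 2")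
        case True
        have "(R / 2)\<^sup>2 \<le> \<rho>\<^sup>2" using True R1 by (intro power_mono) auto
        then have "E / \<rho>\<^sup>2 \<le> E / (R / 2)\<^sup>2" using E0 R1 \<rho> by (intro divide_left_mono) auto
        then have "(1 + c) * (E / \<rho>\<^sup>2) \<le> (1 + c) * (E / (R / 2)\<^sup>2)" using c0 by (intro mult_left_mono) auto
        also have "\<dots> = 4 * E * (1 + c) / R\<^sup>2" by (simp add: power_divide)
        finally have e4: "norm e + c / R\<^sup>2 * norm e \<le> 4 * E * (1 + c) / R\<^sup>2" using e3 by simp
        have "c / \<rho> * (1 - \<rho>\<^sup>2 / R\<^sup>2) = c * (R + \<rho>) / (\<rho> * R\<^sup>2) * (R - \<rho>)"
          using \<rho> R1 by (simp add: field_simps power2_eq_square)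
        also have "\<dots> \<le> 1 * (R - \<rho>)"
        proof (intro mult_right_mono)
          have "c * (R + \<rho>) \<le> c * (2 * R)" using \<rho> c0 by (intro mult_left_mono) auto
          also have "\<dots> = (2 * c) * R" by simp
          also have "\<dots> \<le> R * R" using R1 by (intro mult_right_mono) auto
          also have "\<dots> \<le> \<rho> * R\<^sup>2" using \<rho> R1 by (simp add: power2_eq_square)
          finally show "c * (R + \<rho>) / (\<rho> * R\<^sup>2) \<le> 1" using \<rho> R1 by simp
        qed (use \<rho> in simp)
        finally have t2: "c / \<rho> * (1 - \<rho>\<^sup>2 / R\<^sup>2) \<le> R - \<rho>" by simp
        have "C / R\<^sup>2 = c\<^sup>2 / R\<^sup>2 + 4 * E * (1 + c) / R\<^sup>2" by (simp add: C_def add_divide_distrib)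
        then show ?thesis using t2 t3 e4 by (simp add: \<rho>_def)
      next
        case False
        have "c / \<rho> * (1 - \<rho>\<^sup>2 / R\<^sup>2) \<le> c / 1 * 1"
          using \<rho> c0 by (intro mult_mono divide_left_mono) (auto simp: divide_le_eq power_mono)
        moreover have "c\<^sup>2 / R\<^sup>2 \<le> c\<^sup>2" using \<open>1 \<le> R\<^sup>2\<close> by (simp add: divide_le_eq mult_le_cancel_left1)
        moreover have "(1 + c) * (E / \<rho>\<^sup>2) \<le> (1 + c) * E"
        proof -
          have "1 \<le> \<rho>\<^sup>2" using \<rho> by (simp add: one_le_power)
          then have "E / \<rho>\<^sup>2 \<le> E" using E0 by (simp add: divide_le_eq mult_le_cancel_left1)
          then show ?thesis using c0 by (intro mult_left_mono) auto
        qed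
        moreover have "0 \<le> C / R\<^sup>2" using c0 E0 by (simp add: C_def)
        ultimately show ?thesis using False t3 e3 R1(3) unfolding \<rho>_def[symmetric] q_def by (simp add: algebra_simps)
      qed
    qed
    finally show ?thesis by (simp add: dist_norm norm_minus_commute)
  qed
  show ?thesis
  proof (rule that[of C])
    show "C \<ge> 0" using c0 E0 by (simp add: C_def)
    show "\<forall>\<^sub>F R in at_top. \<forall>z. r \<le> norm z \<and> norm z \<le> R \<longrightarrow>
           g z - k R * cnj (g z) \<in> cball (b 0 - k R * cnj (b 0)) (R + C / R\<^sup>2)"
      using main by (intro eventually_at_top_linorderI[of R0]) blast
  qed
qed

section \<open>Gronwall's area theorem\<close>

text \<open>
  For fixed \<open>r > 1\<close> the two area bounds leave, as \<open>R\<close> tends to infinity, the inequality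
  \<open>\<Sum>\<^bsub>n \<le> N\<^esub> n |b\<^sub>n|\<^sup>2 r\<^sup>-\<^sup>2\<^sup>n \<le> r\<^sup>2\<close>, and \<open>r \<rightarrow> 1\<close> gives the theorem.
\<close>

theorem Gronwall_area_theorem:
  fixes g :: "complex \<Rightarrow> complex" and b :: "nat \<Rightarrow> complex"
  assumes inj: "inj_on g {z. norm z > 1}"
    and expansion: "\<And>z. norm z > 1 \<Longrightarrow> (\<lambda>n. b (Suc n) * inverse z ^ Suc n) sums (g z - (z + b 0))"
  shows "summable (\<lambda>n. real (Suc n) * (norm (b (Suc n)))\<^sup>2)"
    and "(\<Sum>n. real (Suc n) * (norm (b (Suc n)))\<^sup>2) \<le> 1"
proof -
  \<comment> \<open>In the variable \<open>x = 1 / z\<close> the expansion is a power series on the unit disc.\<close>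
  have conv: "summable (\<lambda>n. b n * x ^ n)" if "norm x < 1" for x
  proof (cases "x = 0")
    case False
    then have "norm (inverse x) > 1" using that by (simp add: norm_inverse one_less_inverse_iff)
    from sums_summable[OF expansion[OF this]] show ?thesis
      by (simp only: inverse_inverse_eq summable_Suc_iff[of "\<lambda>n. b n * x ^ n"])
  qed (simp add: powser_zero summable_0_powser)
  have conv': "summable (\<lambda>n. diffs b n * x ^ n)" if "norm x < 1" for x
    using that conv by (rule termdiff_converges[where K = 1])
  have g_eq: "g z = z + (\<Sum>n. b n * inverse z ^ n)" if "norm z > 1" for z
  proof -
    have "norm (inverse z) < 1" using that by (simp add: norm_inverse inverse_less_1_iff)
    from suminf_split_head[OF conv[OF this]] sums_unique[OF expansion[OF that]] show ?thesis
      by (simp add: diff_eq_eq add.commute)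
  qed
  define \<phi> where "\<phi> = (\<lambda>w. exp w - exp (- w) * (\<Sum>n. diffs b n * exp (- w) ^ n))"
  have norm_exp_gt: "norm (exp w) > 1" if "Re w > 0" for w :: complex
    using that by simp
  have der: "((\<lambda>w. g (exp w)) has_field_derivative \<phi> w) (at w)" if w: "Re w > 0" for w
  proof -
    have "((\<lambda>x. \<Sum>n. b n * x ^ n) has_field_derivative (\<Sum>n. diffs b n * exp (- w) ^ n)) (at (exp (- w)))"
      using w by (intro termdiffs_strong'[of 1] conv) simp_all
    then have "((\<lambda>w. \<Sum>n. b n * exp (- w) ^ n) has_field_derivative
        (\<Sum>n. diffs b n * exp (- w) ^ n) * - exp (- w)) (at w)"
      by (rule DERIV_chain2[where g = "\<lambda>w. exp (- w)"]) (auto intro!: derivative_eq_intros)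
    then have "((\<lambda>w. exp w + (\<Sum>n. b n * exp (- w) ^ n)) has_field_derivative \<phi> w) (at w)"
      unfolding \<phi>_def by (auto intro!: derivative_eq_intros simp: mult.commute)
    moreover have "\<forall>\<^sub>F v in nhds w. exp v + (\<Sum>n. b n * exp (- v) ^ n) = g (exp v)"
    proof (rule eventually_nhds_in_open[THEN eventually_mono])
      show "open {v. Re v > 0}" by (simp add: open_halfspace_Re_gt)
    qed (use w in \<open>simp_all add: g_eq norm_exp_gt exp_minus\<close>)
    ultimately show ?thesis by (simp add: DERIV_cong_ev)
  qed
  have cont: "continuous_on {w. Re w > 0} \<phi>"
  proof -
    have "continuous_on (ball 0 1) (\<lambda>x. \<Sum>n. diffs b n * x ^ n)"
      using termdiffs_strong'[OF conv'] by (intro DERIV_continuous_on) (auto intro: DERIV_subset)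
    then have "continuous_on {w. Re w > 0} (\<lambda>w. \<Sum>n. diffs b n * exp (- w) ^ n)"
      by (rule continuous_on_compose2) (auto intro!: continuous_intros)
    then show ?thesis unfolding \<phi>_def by (intro continuous_intros)
  qed
  have inj_exp: "inj_on (\<lambda>w. g (exp w)) {w. Re w \<in> {\<alpha><..<\<beta>} \<and> Im w \<in> {0<..<2 * pi}}" if "\<alpha> > 0" for \<alpha> \<beta>
  proof (rule inj_onI)
    fix v w assume *: "v \<in> {w. Re w \<in> {\<alpha><..<\<beta>} \<and> Im w \<in> {0<..<2 * pi}}"
      "w \<in> {w. Re w \<in> {\<alpha><..<\<beta>} \<and> Im w \<in> {0<..<2 * pi}}" "g (exp v) = g (exp w)"
    have "exp v = exp w"
      using * that by (intro inj_onD[OF inj *(3)]) simp_all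
    then show "v = w" by (rule exp_complex_eqI[rotated]) (use * in auto)
  qed
  have bound_r: "(\<Sum>n<N. real (Suc n) * (norm (b (Suc n)))\<^sup>2 * r powr (- (2 * real (Suc n)))) \<le> r\<^sup>2"
    if r: "r > 1" for r N
  proof -
    define S where "S = (\<Sum>n<N. real (Suc n) * (norm (b (Suc n)))\<^sup>2 * r powr (- (2 * real (Suc n))))"
    define T where "T = (\<Sum>n<N. real (Suc n) * (norm (b (Suc n)))\<^sup>2)"
    define c where "c = (norm (b 1))\<^sup>2"
    obtain C where C: "C \<ge> 0" and disc: "\<forall>\<^sub>F R in at_top. \<forall>z. r \<le> norm z \<and> norm z \<le> R \<longrightarrow>
        (z + (\<Sum>n. b n * inverse z ^ n)) - b 1 / of_real (R\<^sup>2) * cnj (z + (\<Sum>n. b n * inverse z ^ n))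
          \<in> cball (b 0 - b 1 / of_real (R\<^sup>2) * cnj (b 0)) (R + C / R\<^sup>2)"
      using Laurent_image_in_disc[OF conv r] by blast
    \<comment> \<open>The lower and the upper bound for the area, with \<open>R\<^sup>2\<close> as the common leading term;
      \<open>T / R\<^sup>2\<close> dominates the part of the sum that belongs to the outer circle.\<close>
    have "\<forall>\<^sub>F R in at_top. (1 - c / R ^ 4) * (R\<^sup>2 + (S - r\<^sup>2) - T / R\<^sup>2) \<le> (R + C / R\<^sup>2)\<^sup>2"
      using disc eventually_gt_at_top[of r] eventually_gt_at_top[of "norm (b 1)"]
    proof eventually_elim
      case (elim R)
      define k where "k = b 1 / of_real (R\<^sup>2)"
      have R: "R > 1" "R > 0" using elim r by auto
      have "norm (b 1) < R\<^sup>2" using elim R by (smt (verit) power2_eq_square mult_less_cancel_left1 self_le_power)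
      then have k: "norm k < 1" using R by (simp add: k_def norm_divide norm_power)
      have k2: "(norm k)\<^sup>2 = c / R ^ 4"
        by (simp add: k_def c_def norm_divide norm_power power_divide flip: power_mult)
      let ?I = "integral {ln r..ln R} (\<lambda>s. integral {0..2 * pi} (\<lambda>t. (norm (\<phi> (Complex s t)))\<^sup>2))"
      have ln: "0 < ln r" "ln r \<le> ln R" using r elim by auto
      have exp_ln2: "exp (2 * ln x) = x\<^sup>2" if "x > 0" for x :: real
        using that by (simp add: exp_double)
      have exp_powr: "exp (- (2 * real (Suc n) * ln x)) = x powr (- (2 * real (Suc n)))" if "x > 0" for x n
        using that by (simp add: powr_def algebra_simps)
      have "(1 - (norm k)\<^sup>2) * ?I \<le> pi * (R + C / R\<^sup>2)\<^sup>2"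
      proof (rule area_image_le[where F = "\<lambda>w. g (exp w)" and q = "b 0 - k * cnj (b 0)"])
        show "continuous_on {w. Re w \<in> {ln r..ln R} \<and> Im w \<in> {0..2 * pi}} \<phi>"
          by (rule continuous_on_subset[OF cont]) (use ln in auto)
        show "g (exp w) - k * cnj (g (exp w)) \<in> cball (b 0 - k * cnj (b 0)) (R + C / R\<^sup>2)"
          if "Re w \<in> {ln r<..<ln R}" "Im w \<in> {0<..<2 * pi}" for w
        proof -
          have "exp (ln r) \<le> exp (Re w)" "exp (Re w) \<le> exp (ln R)" using that by (simp_all del: exp_ln)
          then have "r \<le> norm (exp w)" "norm (exp w) \<le> R" using r R by simp_all
          moreover from this have "g (exp w) = exp w + (\<Sum>n. b n * inverse (exp w) ^ n)"
            using r by (intro g_eq) linarith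
          ultimately show ?thesis using elim(1) unfolding k_def by simp
        qed
        show "inj_on (\<lambda>w. g (exp w)) {w. Re w \<in> {ln r<..<ln R} \<and> Im w \<in> {0<..<2 * pi}}"
          by (rule inj_exp[OF ln(1)])
        show "0 \<le> R + C / R\<^sup>2" using R C by simp
      qed (use ln in \<open>auto intro!: der k\<close>)
      moreover have "pi * (R\<^sup>2 - r\<^sup>2 + (S - (\<Sum>n<N. real (Suc n) * (norm (b (Suc n)))\<^sup>2 * R powr (- (2 * real (Suc n)))))) \<le> ?I"
        using area_lower_bound[OF conv' cont[unfolded \<phi>_def] ln, of N] r R
        unfolding \<phi>_def S_def
        by (simp add: exp_ln2 exp_powr right_diff_distrib sum_subtractf del: of_nat_Suc)
      moreover have "(\<Sum>n<N. real (Suc n) * (norm (b (Suc n)))\<^sup>2 * R powr (- (2 * real (Suc n)))) \<le> T / R\<^sup>2"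
      proof -
        have "R powr (- (2 * real (Suc n))) \<le> 1 / R\<^sup>2" for n
        proof -
          have "R powr (- (2 * real (Suc n))) \<le> R powr (- 2)" using R by (intro powr_mono) auto
          also have "\<dots> = 1 / R\<^sup>2" using R by (simp add: powr_minus divide_inverse)
          finally show ?thesis .
        qed
        then show ?thesis
          unfolding T_def sum_divide_distrib
          using mult_left_mono[of "R powr (- (2 * real (Suc n)))" "1 / R\<^sup>2" "real (Suc n) * (norm (b (Suc n)))\<^sup>2" for n]
          by (intro sum_mono) (simp del: of_nat_Suc)
      qed
      ultimately have "(1 - (norm k)\<^sup>2) * ?I \<le> pi * (R + C / R\<^sup>2)\<^sup>2"
        and "pi * (R\<^sup>2 - r\<^sup>2 + (S - T / R\<^sup>2)) \<le> ?I"
        by (auto intro: order_trans[rotated])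
      moreover have "0 \<le> 1 - (norm k)\<^sup>2" using k by (simp add: power_le_one)
      ultimately have *: "(1 - (norm k)\<^sup>2) * (pi * (R\<^sup>2 - r\<^sup>2 + (S - T / R\<^sup>2))) \<le> pi * (R + C / R\<^sup>2)\<^sup>2"
        by (meson mult_left_mono order_trans)
      have "pi * ((1 - c / R ^ 4) * (R\<^sup>2 + (S - r\<^sup>2) - T / R\<^sup>2)) \<le> pi * (R + C / R\<^sup>2)\<^sup>2"
      proof -
        have "R\<^sup>2 - r\<^sup>2 + (S - T / R\<^sup>2) = R\<^sup>2 + (S - r\<^sup>2) - T / R\<^sup>2" by simp
        then show ?thesis using * unfolding k2 by (simp only: mult.left_commute[of "1 - c / R ^ 4" pi])
      qed
      then show ?case by simp
    qed
    then have "\<forall>\<^sub>F R in at_top. 0 \<le> (R + C / R\<^sup>2)\<^sup>2 - (1 - c / R ^ 4) * (R\<^sup>2 + (S - r\<^sup>2) - T / R\<^sup>2)"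
      by eventually_elim simp
    moreover have "((\<lambda>R. (R + C / R\<^sup>2)\<^sup>2 - (1 - c / R ^ 4) * (R\<^sup>2 + (S - r\<^sup>2) - T / R\<^sup>2)) \<longlongrightarrow> - (S - r\<^sup>2)) at_top"
      by real_asymp
    ultimately have "0 \<le> - (S - r\<^sup>2)" by (intro tendsto_lowerbound) auto
    then show ?thesis by (simp add: S_def)
  qed
  have partial: "(\<Sum>n<N. real (Suc n) * (norm (b (Suc n)))\<^sup>2) \<le> 1" for N
  proof -
    have "((\<lambda>r. \<Sum>n<N. real (Suc n) * (norm (b (Suc n)))\<^sup>2 * r powr (- (2 * real (Suc n))))
        \<longlongrightarrow> (\<Sum>n<N. real (Suc n) * (norm (b (Suc n)))\<^sup>2 * 1 powr (- (2 * real (Suc n))))) (at_right 1)"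
      by (intro tendsto_intros) auto
    moreover have "((\<lambda>r::real. r\<^sup>2) \<longlongrightarrow> 1\<^sup>2) (at_right 1)" by (intro tendsto_intros)
    moreover have "\<forall>\<^sub>F r in at_right 1. (\<Sum>n<N. real (Suc n) * (norm (b (Suc n)))\<^sup>2 * r powr (- (2 * real (Suc n)))) \<le> r\<^sup>2"
      using bound_r by (auto simp: eventually_at_right_field intro: exI[of _ 2])
    ultimately have "(\<Sum>n<N. real (Suc n) * (norm (b (Suc n)))\<^sup>2 * 1 powr (- (2 * real (Suc n)))) \<le> (1::real)\<^sup>2"
      by (intro tendsto_le) auto
    then show ?thesis by (simp del: of_nat_Suc)
  qed
  show sm: "summable (\<lambda>n. real (Suc n) * (norm (b (Suc n)))\<^sup>2)"
    using partial by (intro summableI_nonneg_bounded[of _ 1]) auto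
  show "(\<Sum>n. real (Suc n) * (norm (b (Suc n)))\<^sup>2) \<le> 1"
    by (intro suminf_le_const sm partial)
qed

section \<open>Idempotent components of bicomplex functions\<close>

lemma beta_algebra:
  "\<beta>\<^sub>1 (Z + W) = \<beta>\<^sub>1 Z + \<beta>\<^sub>1 W" "\<beta>\<^sub>2 (Z + W) = \<beta>\<^sub>2 Z + \<beta>\<^sub>2 W"
  "\<beta>\<^sub>1 (Z - W) = \<beta>\<^sub>1 Z - \<beta>\<^sub>1 W" "\<beta>\<^sub>2 (Z - W) = \<beta>\<^sub>2 Z - \<beta>\<^sub>2 W"
  "\<beta>\<^sub>1 (Z * W) = \<beta>\<^sub>1 Z * \<beta>\<^sub>1 W" "\<beta>\<^sub>2 (Z * W) = \<beta>\<^sub>2 Z * \<beta>\<^sub>2 W"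
  "\<beta>\<^sub>1 1 = 1" "\<beta>\<^sub>2 1 = 1"
  by (simp_all add: bicomplex_unfold algebra_simps)

lemma beta_power: "\<beta>\<^sub>1 (Z ^ n) = \<beta>\<^sub>1 Z ^ n" "\<beta>\<^sub>2 (Z ^ n) = \<beta>\<^sub>2 Z ^ n"
  by (induction n) (simp_all add: beta_algebra)

lemma beta_inverse:
  assumes "Z \<notin> \<O>\<^sub>0"
  shows "\<beta>\<^sub>1 (inverse Z) = inverse (\<beta>\<^sub>1 Z)" "\<beta>\<^sub>2 (inverse Z) = inverse (\<beta>\<^sub>2 Z)"
proof -
  have "\<beta>\<^sub>1 Z * \<beta>\<^sub>1 (inverse Z) = 1" "\<beta>\<^sub>2 Z * \<beta>\<^sub>2 (inverse Z) = 1"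
    unfolding beta_algebra(5,6)[symmetric] mult_inverse_bicomplex[OF assms] by (fact beta_algebra)+
  then show "\<beta>\<^sub>1 (inverse Z) = inverse (\<beta>\<^sub>1 Z)" "\<beta>\<^sub>2 (inverse Z) = inverse (\<beta>\<^sub>2 Z)"
    by (metis inverse_unique)+
qed

lemma bounded_linear_beta: "bounded_linear \<beta>\<^sub>1" "bounded_linear \<beta>\<^sub>2"
proof -
  note snd = bounded_linear_compose[OF bounded_linear_mult_right bounded_linear_BC(2), of \<i>]
  show "bounded_linear \<beta>\<^sub>1" "bounded_linear \<beta>\<^sub>2"
    unfolding \<beta>\<^sub>1_def[abs_def] \<beta>\<^sub>2_def[abs_def]
    by (rule bounded_linear_sub[OF bounded_linear_BC(1) snd] bounded_linear_add[OF bounded_linear_BC(1) snd])+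
qed

lemma hnorm_square: "\<bar>Z\<bar>\<^sub>k ^ 2 = (norm (\<beta>\<^sub>1 Z))\<^sup>2 *\<^sub>R e1 + (norm (\<beta>\<^sub>2 Z))\<^sup>2 *\<^sub>R e2"
proof -
  have "e2 * e1 = 0" using idempotents(2) by (simp add: mult.commute)
  then show ?thesis
    unfolding hnorm_def power2_eq_square
    by (simp add: distrib_left distrib_right idempotents)
qed

text \<open>
  The factors of a product set are determined by it only if both are nonempty; a point of modulus \<open>2\<close>
  in the other coordinate supplies this.
\<close>

lemma idem_set_eq_DeltaD:
  assumes "Delta = idem_set \<Omega>\<^sub>1 \<Omega>\<^sub>2"
  shows "\<Omega>\<^sub>1 = {z. norm z > 1}" "\<Omega>\<^sub>2 = {z. norm z > 1}"
proof -
  have *: "z \<in> \<Omega>\<^sub>1 \<and> w \<in> \<Omega>\<^sub>2 \<longleftrightarrow> norm z > 1 \<and> norm w > 1" for z w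
  proof -
    have "of_C z * e1 + of_C w * e2 \<in> idem_set \<Omega>\<^sub>1 \<Omega>\<^sub>2 \<longleftrightarrow> z \<in> \<Omega>\<^sub>1 \<and> w \<in> \<Omega>\<^sub>2"
      unfolding idem_set_def mem_Collect_eq by (metis beta_idempotent)
    then show ?thesis unfolding assms[symmetric] Delta_iff by simp
  qed
  have "norm (2 :: complex) > 1" by simp
  with * show "\<Omega>\<^sub>1 = {z. norm z > 1}" "\<Omega>\<^sub>2 = {z. norm z > 1}" by blast+
qed

theorem theorem2p2:
  fixes G :: "bicomplex \<Rightarrow> bicomplex" and B :: "nat \<Rightarrow> bicomplex"
  assumes "G \<in> Sigma_class"
    and "has_expansion G B"
  shows "summable (\<lambda>n. of_nat (Suc n) * \<bar>B (Suc n)\<bar>\<^sub>k ^ 2)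
         \<and> (\<Sum>n. of_nat (Suc n) * \<bar>B (Suc n)\<bar>\<^sub>k ^ 2) \<preceq> 1"
proof -
  let ?E = "{z :: complex. norm z > 1}"
  have uni: "bc_univalent_on G Delta" using assms(1) by (simp add: Sigma_class_def)
  then have inj: "\<And>Z W. \<lbrakk>Z \<in> Delta; W \<in> Delta; G Z = G W\<rbrakk> \<Longrightarrow> Z = W"
    unfolding bc_univalent_on_def by meson
  from uni have "product_type_on Delta G" by (simp add: bc_univalent_on_def)
  then obtain \<Omega>\<^sub>1 \<Omega>\<^sub>2 G\<^sub>1 G\<^sub>2 where \<Omega>: "Delta = idem_set \<Omega>\<^sub>1 \<Omega>\<^sub>2"
    and split: "\<forall>z\<in>\<Omega>\<^sub>1. \<forall>w\<in>\<Omega>\<^sub>2. G (of_C z * e1 + of_C w * e2) = of_C (G\<^sub>1 z) * e1 + of_C (G\<^sub>2 w) * e2"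
    unfolding product_type_on_def by (elim exE conjE)
  have GE: "G (of_C z * e1 + of_C w * e2) = of_C (G\<^sub>1 z) * e1 + of_C (G\<^sub>2 w) * e2"
    if "norm z > 1" "norm w > 1" for z w
    using split that unfolding idem_set_eq_DeltaD[OF \<Omega>] by simp
  have in_Delta: "of_C z * e1 + of_C w * e2 \<in> Delta" if "norm z > 1" "norm w > 1" for z w
    using that by (simp add: Delta_iff)
  have two: "norm (2 :: complex) > 1" by simp
  \<comment> \<open>Injectivity of one component: put the fixed point \<open>2\<close> into the other one.\<close>
  have inj1: "inj_on G\<^sub>1 ?E"
  proof (rule inj_onI)
    fix z z' assume *: "z \<in> ?E" "z' \<in> ?E" "G\<^sub>1 z = G\<^sub>1 z'"
    then have "G (of_C z * e1 + of_C 2 * e2) = G (of_C z' * e1 + of_C 2 * e2)"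
      using GE two by simp
    then have "of_C z * e1 + of_C 2 * e2 = of_C z' * e1 + of_C 2 * e2"
      by (rule inj[rotated 2]) (use * two in_Delta in auto)
    then show "z = z'" by (metis beta_idempotent(1))
  qed
  have inj2: "inj_on G\<^sub>2 ?E"
  proof (rule inj_onI)
    fix w w' assume *: "w \<in> ?E" "w' \<in> ?E" "G\<^sub>2 w = G\<^sub>2 w'"
    then have "G (of_C 2 * e1 + of_C w * e2) = G (of_C 2 * e1 + of_C w' * e2)"
      using GE two by simp
    then have "of_C 2 * e1 + of_C w * e2 = of_C 2 * e1 + of_C w' * e2"
      by (rule inj[rotated 2]) (use * two in_Delta in auto)
    then show "w = w'" by (metis beta_idempotent(2))
  qed
  \<comment> \<open>The expansion of each component comes from the diagonal points \<open>z e\<^sub>1 + z e\<^sub>2\<close>.\<close>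
  have exp: "(\<lambda>n. \<beta>\<^sub>1 (B (Suc n)) * inverse z ^ Suc n) sums (G\<^sub>1 z - (z + \<beta>\<^sub>1 (B 0)))"
    "(\<lambda>n. \<beta>\<^sub>2 (B (Suc n)) * inverse z ^ Suc n) sums (G\<^sub>2 z - (z + \<beta>\<^sub>2 (B 0)))"
    if z: "norm z > 1" for z
  proof -
    define Z where "Z = of_C z * e1 + of_C z * e2"
    have \<beta>: "\<beta>\<^sub>1 Z = z" "\<beta>\<^sub>2 Z = z" by (simp_all add: Z_def)
    have G: "\<beta>\<^sub>1 (G Z) = G\<^sub>1 z" "\<beta>\<^sub>2 (G Z) = G\<^sub>2 z" using GE[OF z z] by (simp_all add: Z_def)
    have nz: "Z \<notin> \<O>\<^sub>0" using z by (auto simp: zero_divisors0_iff \<beta>)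
    have "(\<lambda>n. B (Suc n) * inverse Z ^ Suc n) sums (G Z - (Z + B 0))"
      using assms(2) in_Delta[OF z z] by (simp add: has_expansion_def Z_def)
    from bounded_linear.sums[OF bounded_linear_beta(1) this] bounded_linear.sums[OF bounded_linear_beta(2) this]
    show "(\<lambda>n. \<beta>\<^sub>1 (B (Suc n)) * inverse z ^ Suc n) sums (G\<^sub>1 z - (z + \<beta>\<^sub>1 (B 0)))"
      "(\<lambda>n. \<beta>\<^sub>2 (B (Suc n)) * inverse z ^ Suc n) sums (G\<^sub>2 z - (z + \<beta>\<^sub>2 (B 0)))"
      unfolding beta_algebra beta_power beta_inverse[OF nz] \<beta> G .
  qed
  let ?s = "\<lambda>\<beta> n. real (Suc n) * (norm (\<beta> (B (Suc n)) :: complex))\<^sup>2"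
  note area1 = Gronwall_area_theorem[OF inj1 exp(1)] and area2 = Gronwall_area_theorem[OF inj2 exp(2)]
  have summand: "of_nat (Suc n) * \<bar>B (Suc n)\<bar>\<^sub>k ^ 2 = ?s \<beta>\<^sub>1 n *\<^sub>R e1 + ?s \<beta>\<^sub>2 n *\<^sub>R e2" for n
    unfolding hnorm_square scaleR_scaleR[symmetric] scaleR_right_distrib[symmetric]
    by (simp add: scaleR_conv_of_real)
  have "(\<lambda>n. of_nat (Suc n) * \<bar>B (Suc n)\<bar>\<^sub>k ^ 2) sums (suminf (?s \<beta>\<^sub>1) *\<^sub>R e1 + suminf (?s \<beta>\<^sub>2) *\<^sub>R e2)"
    unfolding summand
    by (intro sums_add bounded_linear.sums[OF bounded_linear_scaleR_left] summable_sums area1(1) area2(1))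
  moreover have "suminf (?s \<beta>\<^sub>1) *\<^sub>R e1 + suminf (?s \<beta>\<^sub>2) *\<^sub>R e2 \<preceq> 1"
  proof -
    have "1 = (1::real) *\<^sub>R e1 + (1::real) *\<^sub>R e2" by (simp add: idempotents)
    then show ?thesis unfolding hle_def using area1(2) area2(2) by blast
  qed
  ultimately show ?thesis by (simp only: sums_iff)
qed

end
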